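(* Let $\mathcal{H}$ be a separable complex Hilbert space and let $T\in\mathcal{B}(\mathcal{H})$ be a pure hyponormal contraction. Then $T$ is unitarily equivalent to an operator of the form $$\begin{bmatrix} S&A\\0&B\end{bmatrix}\in\mathcal{B}\big((\mathcal{H}\ominus\mathcal{D}_T)\oplus\mathcal{D}_T\big),$$ where $B\in\mathcal{B}(\mathcal{D}_T)$ is a contraction, $S\in\mathcal{B}(\mathcal{H}\ominus\mathcal{D}_T)$ is a unilateral shift, and $A\in\mathcal{B}(\mathcal{D}_T,\mathcal{H}\ominus\mathcal{D}_T)$ satisfies $S^*A=0$.
   Context: $T\in\mathcal{B}(\mathcal{H})$ is hyponormal if $TT^*\le T^*T$, and a contraction if $\|T\|\le1$. A hyponormal operator is pure if there is no nonzero closed reducing subspace on which its restriction is normal. For a contraction $T$, $D_T=(I-T^*T)^{1/2}$ and $\mathcal{D}_T$ is the closure of the range of $D_T$; $\mathcal{H}\ominus\mathcal{D}_T$ is its orthogonal complement in $\mathcal{H}$. A unilateral shift is an isometry without a nonzero unitary direct summand (the operator on the zero space is allowed). *)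

theory Defs
  imports "HOL-Analysis.Analysis"
begin

text \<open>
  Complex Hilbert spaces are built on top of the library's real inner product spaces, so that
  the norm and the topology are the library's; the real inner product is the real part of the
  complex one. The complex inner product is linear in its first argument.
\<close>

class complex_inner = real_inner +
  fixes scaleC :: "complex \<Rightarrow> 'a \<Rightarrow> 'a" (infixr "*\<^sub>C" 75)
    and cinner :: "'a \<Rightarrow> 'a \<Rightarrow> complex"
  assumes scaleC_add_right: "a *\<^sub>C (x + y) = a *\<^sub>C x + a *\<^sub>C y"
    and scaleC_add_left: "(a + b) *\<^sub>C x = a *\<^sub>C x + b *\<^sub>C x"
    and scaleC_scaleC: "a *\<^sub>C (b *\<^sub>C x) = (a * b) *\<^sub>C x"
    and scaleC_of_real: "complex_of_real r *\<^sub>C x = r *\<^sub>R x"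
    and cinner_commute: "cinner x y = cnj (cinner y x)"
    and cinner_add_left: "cinner (x + y) z = cinner x z + cinner y z"
    and cinner_scaleC_left: "cinner (a *\<^sub>C x) y = a * cinner x y"
    and Re_cinner: "Re (cinner x y) = inner x y"

class complex_hilbert = complex_inner + complete_space

global_interpretation complex_vector: vector_space "scaleC :: complex \<Rightarrow> 'a \<Rightarrow> 'a::complex_inner"
proof
  fix a b :: complex and x y :: 'a
  show "a *\<^sub>C (x + y) = a *\<^sub>C x + a *\<^sub>C y" by (rule scaleC_add_right)
  show "(a + b) *\<^sub>C x = a *\<^sub>C x + b *\<^sub>C x" by (rule scaleC_add_left)
  show "a *\<^sub>C b *\<^sub>C x = (a * b) *\<^sub>C x" by (rule scaleC_scaleC)
  show "1 *\<^sub>C x = x" using scaleC_of_real[of 1 x] by simp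
qed

text \<open>The Hilbert space direct sum of two spaces.\<close>

instantiation prod :: (complex_inner, complex_inner) complex_inner
begin

definition scaleC_prod :: "complex \<Rightarrow> 'a \<times> 'b \<Rightarrow> 'a \<times> 'b" where
  "scaleC_prod a p = (a *\<^sub>C fst p, a *\<^sub>C snd p)"

definition cinner_prod :: "'a \<times> 'b \<Rightarrow> 'a \<times> 'b \<Rightarrow> complex" where
  "cinner_prod p q = cinner (fst p) (fst q) + cinner (snd p) (snd q)"

instance
proof
  fix a b :: complex and r :: real and x y z :: "'a \<times> 'b"
  show "a *\<^sub>C (x + y) = a *\<^sub>C x + a *\<^sub>C y"
    by (simp add: scaleC_prod_def scaleC_add_right)
  show "(a + b) *\<^sub>C x = a *\<^sub>C x + b *\<^sub>C x"
    by (simp add: scaleC_prod_def scaleC_add_left)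
  show "a *\<^sub>C (b *\<^sub>C x) = (a * b) *\<^sub>C x"
    by (simp add: scaleC_prod_def scaleC_scaleC)
  show "complex_of_real r *\<^sub>C x = r *\<^sub>R x"
    by (simp add: scaleC_prod_def scaleC_of_real scaleR_prod_def)
  show "cinner x y = cnj (cinner y x)"
    by (simp add: cinner_prod_def cinner_commute[of "fst x"] cinner_commute[of "snd x"])
  show "cinner (x + y) z = cinner x z + cinner y z"
    by (simp add: cinner_prod_def cinner_add_left)
  show "cinner (a *\<^sub>C x) y = a * cinner x y"
    by (simp add: cinner_prod_def scaleC_prod_def cinner_scaleC_left distrib_left)
  show "Re (cinner x y) = inner x y"
    by (simp add: cinner_prod_def Re_cinner inner_prod_def)
qed

end

instance prod :: (complex_hilbert, complex_hilbert) complex_hilbert ..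

text \<open>
  The Hilbert spaces of the theory are the closed subspaces of a type of class
  \<^class>\<open>complex_hilbert\<close> (or of a product of two such types); \<^term>\<open>UNIV\<close> is the whole space.
  An operator is a function together with its domain \<open>M\<close> and codomain \<open>N\<close>; its values outside \<open>M\<close>
  are irrelevant, so restricting an operator only means changing \<open>M\<close> and \<open>N\<close>.
\<close>

definition closed_csubspace :: "'a::complex_inner set \<Rightarrow> bool" where
  "closed_csubspace M \<longleftrightarrow> complex_vector.subspace M \<and> closed M"

definition ominus :: "'a::complex_inner set \<Rightarrow> 'a set \<Rightarrow> 'a set" (infixl "\<ominus>\<^sub>H" 65) where
  "M \<ominus>\<^sub>H N = {x \<in> M. \<forall>y\<in>N. cinner x y = 0}"

definition bounded_op ::
    "'a::complex_inner set \<Rightarrow> 'b::complex_inner set \<Rightarrow> ('a \<Rightarrow> 'b) \<Rightarrow> bool" where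
  "bounded_op M N T \<longleftrightarrow>
     (\<forall>x\<in>M. T x \<in> N) \<and>
     (\<forall>x\<in>M. \<forall>y\<in>M. T (x + y) = T x + T y) \<and>
     (\<forall>a. \<forall>x\<in>M. T (a *\<^sub>C x) = a *\<^sub>C T x) \<and>
     (\<exists>K. \<forall>x\<in>M. norm (T x) \<le> K * norm x)"

text \<open>The operator norm; for \<open>M = UNIV\<close> this is the library's \<^const>\<open>onorm\<close>.\<close>

definition op_norm :: "'a::complex_inner set \<Rightarrow> ('a \<Rightarrow> 'b::complex_inner) \<Rightarrow> real" where
  "op_norm M T = (SUP x\<in>M. norm (T x) / norm x)"

definition adj ::
    "'a::complex_inner set \<Rightarrow> ('a \<Rightarrow> 'b::complex_inner) \<Rightarrow> 'b \<Rightarrow> 'a" where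
  "adj M T y = (THE z. z \<in> M \<and> (\<forall>x\<in>M. cinner (T x) y = cinner x z))"

definition contraction :: "'a::complex_inner set \<Rightarrow> ('a \<Rightarrow> 'a) \<Rightarrow> bool" where
  "contraction M T \<longleftrightarrow> bounded_op M M T \<and> op_norm M T \<le> 1"

definition positive_op :: "'a::complex_inner set \<Rightarrow> ('a \<Rightarrow> 'a) \<Rightarrow> bool" where
  "positive_op M P \<longleftrightarrow> bounded_op M M P \<and> (\<forall>x\<in>M. cinner (P x) x \<in> \<real>\<^sub>\<ge>\<^sub>0)"

definition op_le :: "'a::complex_inner set \<Rightarrow> ('a \<Rightarrow> 'a) \<Rightarrow> ('a \<Rightarrow> 'a) \<Rightarrow> bool" where
  "op_le M P Q \<longleftrightarrow> positive_op M (\<lambda>x. Q x - P x)"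

definition normal_op :: "'a::complex_inner set \<Rightarrow> ('a \<Rightarrow> 'a) \<Rightarrow> bool" where
  "normal_op M T \<longleftrightarrow> bounded_op M M T \<and> (\<forall>x\<in>M. T (adj M T x) = adj M T (T x))"

definition hyponormal :: "'a::complex_inner set \<Rightarrow> ('a \<Rightarrow> 'a) \<Rightarrow> bool" where
  "hyponormal M T \<longleftrightarrow> bounded_op M M T \<and> op_le M (T \<circ> adj M T) (adj M T \<circ> T)"

definition reducing :: "'a::complex_inner set \<Rightarrow> ('a \<Rightarrow> 'a) \<Rightarrow> 'a set \<Rightarrow> bool" where
  "reducing M T N \<longleftrightarrow>
     closed_csubspace N \<and> N \<subseteq> M \<and> T ` N \<subseteq> N \<and> T ` (M \<ominus>\<^sub>H N) \<subseteq> M \<ominus>\<^sub>H N"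

definition pure_hyponormal :: "'a::complex_inner set \<Rightarrow> ('a \<Rightarrow> 'a) \<Rightarrow> bool" where
  "pure_hyponormal M T \<longleftrightarrow>
     hyponormal M T \<and> \<not> (\<exists>N. reducing M T N \<and> N \<noteq> {0} \<and> normal_op N T)"

definition unitary_op ::
    "'a::complex_inner set \<Rightarrow> 'b::complex_inner set \<Rightarrow> ('a \<Rightarrow> 'b) \<Rightarrow> bool" where
  "unitary_op M N U \<longleftrightarrow>
     bounded_op M N U \<and> (\<forall>x\<in>M. \<forall>y\<in>M. cinner (U x) (U y) = cinner x y) \<and> U ` M = N"

definition unitarily_equivalent ::
    "'a::complex_inner set \<Rightarrow> ('a \<Rightarrow> 'a) \<Rightarrow> 'b::complex_inner set \<Rightarrow> ('b \<Rightarrow> 'b) \<Rightarrow> bool" where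
  "unitarily_equivalent M T N T' \<longleftrightarrow>
     (\<exists>U. unitary_op M N U \<and> (\<forall>x\<in>M. U (T x) = T' (U x)))"

definition isometry_op :: "'a::complex_inner set \<Rightarrow> ('a \<Rightarrow> 'a) \<Rightarrow> bool" where
  "isometry_op M V \<longleftrightarrow> bounded_op M M V \<and> (\<forall>x\<in>M. norm (V x) = norm x)"

definition unilateral_shift :: "'a::complex_inner set \<Rightarrow> ('a \<Rightarrow> 'a) \<Rightarrow> bool" where
  "unilateral_shift M S \<longleftrightarrow>
     isometry_op M S \<and> \<not> (\<exists>N. reducing M S N \<and> N \<noteq> {0} \<and> unitary_op N N S)"

text \<open>
  The positive square root of a positive operator on \<open>M\<close> is unique as an operator on \<open>M\<close>; only its
  values outside \<open>M\<close> are left to the choice operator.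
\<close>

definition op_sqrt :: "'a::complex_inner set \<Rightarrow> ('a \<Rightarrow> 'a) \<Rightarrow> ('a \<Rightarrow> 'a)" where
  "op_sqrt M P = (SOME R. positive_op M R \<and> (\<forall>x\<in>M. R (R x) = P x))"

definition defect_op :: "'a::complex_inner set \<Rightarrow> ('a \<Rightarrow> 'a) \<Rightarrow> ('a \<Rightarrow> 'a)" where
  "defect_op M T = op_sqrt M (\<lambda>x. x - adj M T (T x))"

definition defect_space :: "'a::complex_inner set \<Rightarrow> ('a \<Rightarrow> 'a) \<Rightarrow> 'a set" where
  "defect_space M T = closure (defect_op M T ` M)"

text \<open>The operator matrix with rows \<open>(P, Q)\<close> and \<open>(R, S)\<close>.\<close>

definition block_op ::
    "('a::complex_inner \<Rightarrow> 'a) \<Rightarrow> ('b::complex_inner \<Rightarrow> 'a) \<Rightarrow>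
     ('a \<Rightarrow> 'b) \<Rightarrow> ('b \<Rightarrow> 'b) \<Rightarrow> 'a \<times> 'b \<Rightarrow> 'a \<times> 'b" where
  "block_op P Q R S = (\<lambda>(x, y). (P x + Q y, R x + S y))"

end

theory Submission imports Defs begin

text \<open>
  The orthogonal complement \<open>K\<close> of the defect space is the kernel of \<open>I - T\<^sup>*T\<close>, and \<open>T\<close> is isometric
  on it. For \<open>x \<in> K\<close> hyponormality gives \<open>\<parallel>x\<parallel> = \<parallel>T\<^sup>*Tx\<parallel> \<le> \<parallel>TTx\<parallel> \<le> \<parallel>Tx\<parallel> \<le> \<parallel>x\<parallel>\<close>, hence \<open>Tx \<in> K\<close>:
  the space \<open>K\<close> is invariant and \<open>T\<close> is block upper triangular. A unitary summand of \<open>T|K\<close> is invariant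
  under \<open>T\<^sup>*\<close>, because \<open>T\<^sup>*Tx = x\<close> on \<open>K\<close>, so it reduces \<open>T\<close> and is zero by purity. Likewise
  \<open>\<langle>Sx, Ay\<rangle> = \<langle>T\<^sup>*Tx, y\<rangle> = \<langle>x, y\<rangle> = 0\<close> for \<open>x \<in> K\<close> and \<open>y\<close> in the defect space. The square root
  defining the defect operator comes from the binomial series of \<open>(1 - z)\<^bsup>1/2\<^esup>\<close> at \<open>z = T\<^sup>*T\<close>, whose
  coefficients are absolutely summable and negative after the first.
\<close>

section \<open>Riesz representation on closed real subspaces\<close>

text \<open>
  The representing vector minimises \<open>\<parallel>z\<parallel>\<^sup>2 - 2 f(z)\<close>; minimising sequences are Cauchy by the
  parallelogram law. With \<open>f\<close> the inner product with a fixed vector this is orthogonal projection.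
\<close>
lemma inner_riesz_on_subspace:
  fixes M :: "'a::{real_inner,complete_space} set"
  assumes M: "subspace M" "closed M"
    and add: "\<And>x y. x \<in> M \<Longrightarrow> y \<in> M \<Longrightarrow> f (x + y) = f x + f y"
    and scale: "\<And>r x. x \<in> M \<Longrightarrow> f (r *\<^sub>R x) = r * f x"
    and bound: "\<And>x. x \<in> M \<Longrightarrow> \<bar>f x\<bar> \<le> K * norm x"
  obtains z where "z \<in> M" "\<And>y. y \<in> M \<Longrightarrow> inner y z = (f y :: real)"
proof -
  define J where "J z = (norm z)\<^sup>2 - 2 * f z" for z
  define m where "m = (INF z\<in>M. J z)"
  \<comment> \<open>Completing the square: \<open>J z\<close> is at least
    \<open>(norm z)^2 - 2 * K * norm z\<close>, which equals
    \<open>(norm z - K)^2 - K^2\<close>.\<close>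
  have "- K\<^sup>2 \<le> J z" if "z \<in> M" for z
  proof -
    have "0 \<le> (norm z - K)\<^sup>2" by simp
    then show ?thesis
      using bound[OF that] by (simp add: J_def power2_diff algebra_simps abs_le_iff)
  qed
  then have bdd: "bdd_below (J ` M)" by (auto intro!: bdd_belowI2)
  then have m_le: "m \<le> J z" if "z \<in> M" for z
    unfolding m_def using that by (rule cINF_lower)
  have ne: "M \<noteq> {}" using subspace_0[OF M(1)] by auto
  have "\<exists>z\<in>M. J z < m + 1 / real (Suc n)" for n
    using cINF_less_iff[OF ne bdd, of "m + 1 / real (Suc n)"] by (simp add: m_def)
  then obtain z where z: "z n \<in> M" "J (z n) < m + 1 / real (Suc n)" for n by metis
  have par: "(dist u v)\<^sup>2 \<le> 2 * (J u - m) + 2 * (J v - m)" if "u \<in> M" "v \<in> M" for u v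
  proof -
    have mid: "(1/2) *\<^sub>R (u + v) \<in> M"
      using that by (intro subspace_scale subspace_add M)
    \<comment> \<open>The linear parts of \<open>J\<close> cancel because f is additive and
      homogeneous at the midpoint; what remains is the parallelogram law.\<close>
    have "(dist u v)\<^sup>2 = 2 * J u + 2 * J v - 4 * J ((1/2) *\<^sub>R (u + v))"
      unfolding J_def scale[OF subspace_add[OF M(1) that]] add[OF that]
      by (simp add: dist_norm power2_norm_eq_inner inner_simps inner_commute algebra_simps)
    then show ?thesis using m_le[OF mid] by simp
  qed
  have "Cauchy z"
  proof (rule metric_CauchyI)
    fix e :: real assume "e > 0"
    \<comment> \<open>Both deviations from the infimum enter \<open>par\<close> with factor 2, so
      e^2/4 for each adds up to e^2.\<close>
    then obtain N where N: "1 / real (Suc N) < e\<^sup>2 / 4"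
      using nat_approx_posE[of "e\<^sup>2 / 4"] by auto
    have "dist (z i) (z j) < e" if "i \<ge> N" "j \<ge> N" for i j
    proof -
      have "J (z k) < m + e\<^sup>2 / 4" if "k \<ge> N" for k
      proof -
        have "1 / real (Suc k) \<le> 1 / real (Suc N)" using that by (simp add: frac_le)
        then show ?thesis using z(2)[of k] N by argo
      qed
      then have "J (z i) < m + e\<^sup>2 / 4" "J (z j) < m + e\<^sup>2 / 4" using that by auto
      then have "(dist (z i) (z j))\<^sup>2 < e\<^sup>2"
        using par[OF z(1) z(1), of i j] by argo
      then show ?thesis using \<open>e > 0\<close> by (simp add: power_less_imp_less_base)
    qed
    then show "\<exists>N. \<forall>i\<ge>N. \<forall>j\<ge>N. dist (z i) (z j) < e" by blast
  qed
  then obtain w where w: "z \<longlonglongrightarrow> w"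
    using Cauchy_convergent_iff convergent_def by blast
  have wM: "w \<in> M" using closed_sequentially[OF M(2) z(1) w] .
  have Kw: "\<bar>f u - f v\<bar> \<le> K * norm (u - v)" if "u \<in> M" "v \<in> M" for u v
  proof -
    have "f (u - v) = f u - f v"
      using add[OF that(1), of "(-1) *\<^sub>R v"] scale[OF that(2), of "-1"]
        subspace_scale[OF M(1) that(2), of "-1"] by simp
    then show ?thesis using bound[OF subspace_diff[OF M(1) that]] by simp
  qed
  have "(\<lambda>n. f (z n) - f w) \<longlonglongrightarrow> 0"
  proof (rule Lim_null_comparison)
    show "\<forall>\<^sub>F n in sequentially. norm (f (z n) - f w) \<le> K * norm (z n - w)"
      using Kw[OF z(1) wM] by simp
    have "(\<lambda>n. K * norm (z n - w)) \<longlonglongrightarrow> K * norm (w - w)"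
      by (intro tendsto_intros w)
    then show "(\<lambda>n. K * norm (z n - w)) \<longlonglongrightarrow> 0" by simp
  qed
  then have "(\<lambda>n. f (z n)) \<longlonglongrightarrow> f w" by (simp add: LIM_zero_iff)
  then have "(\<lambda>n. J (z n)) \<longlonglongrightarrow> J w"
    unfolding J_def by (intro tendsto_intros w)
  moreover have "(\<lambda>n. m + 1 / real (Suc n)) \<longlonglongrightarrow> m + 0"
    by (intro tendsto_intros) (use LIMSEQ_inverse_real_of_nat in \<open>simp add: inverse_eq_divide\<close>)
  ultimately have Jw: "J w \<le> m"
    using z(2) by (intro LIMSEQ_le[of "\<lambda>n. J (z n)" _ "\<lambda>n. m + 1 / real (Suc n)"])
      (auto intro: less_imp_le)
  have "inner y w = f y" if y: "y \<in> M" for y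
  proof (rule ccontr)
    assume ne: "inner y w \<noteq> f y"
    define d where "d = inner y w - f y"
    \<comment> \<open>With t = -d/c, moving from w to w + ty changes \<open>J\<close> by at most 2td
      + t^2 c = -d^2/c, contradicting minimality. The summand 1 keeps c positive when y = 0.\<close>
    define c where "c = (norm y)\<^sup>2 + 1"
    have "c > 0" unfolding c_def by (intro add_nonneg_pos) auto
    define t where "t = - d / c"
    have "w + t *\<^sub>R y \<in> M" using wM y by (intro subspace_add subspace_scale M)
    then have "m \<le> J (w + t *\<^sub>R y)" by (rule m_le)
    also have "\<dots> = J w + 2 * t * d + t\<^sup>2 * (norm y)\<^sup>2"
      using add[OF wM subspace_scale[OF M(1) y, of t]] scale[OF y, of t]
      by (simp add: J_def d_def power2_norm_eq_inner inner_simps inner_commute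
          algebra_simps power2_eq_square[of t])
    finally have "0 \<le> 2 * t * d + t\<^sup>2 * (norm y)\<^sup>2" using Jw by simp
    also have "\<dots> \<le> 2 * t * d + t\<^sup>2 * c"
      by (simp add: c_def algebra_simps)
    also have "\<dots> = - d\<^sup>2 / c"
      using \<open>c > 0\<close> unfolding t_def by (simp add: field_simps power2_eq_square)
    also have "\<dots> < 0"
      using ne \<open>c > 0\<close> by (auto simp: d_def intro!: divide_neg_pos)
    finally show False by simp
  qed
  with wM show ?thesis by (rule that)
qed

section \<open>Complex inner product algebra and the Cauchy-Schwarz inequality\<close>

lemma cinner_add_right: "cinner x (y + z) = cinner x y + cinner x (z::'a::complex_inner)"
  by (metis cinner_add_left cinner_commute complex_cnj_add)

lemma cinner_scaleC_right: "cinner x (a *\<^sub>C y) = cnj a * cinner x (y::'a::complex_inner)"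
  by (metis cinner_scaleC_left cinner_commute complex_cnj_mult)

lemma cinner_zero [simp]: "cinner 0 (x::'a::complex_inner) = 0" "cinner x 0 = 0"
  using cinner_add_left[of 0 0 x] cinner_add_right[of x 0 0] by simp_all

lemma scaleC_minus1: "(- 1) *\<^sub>C x = - (x::'a::complex_inner)"
  using scaleC_of_real[of "-1" x] by simp

lemma cinner_minus: "cinner (- x) y = - cinner x (y::'a::complex_inner)"
  "cinner x (- y) = - cinner x y"
  using cinner_scaleC_left[of "-1" x y] cinner_scaleC_right[of x "-1" y]
  by (simp_all add: scaleC_minus1)

lemma cinner_diff_left: "cinner (x - y) z = cinner x z - cinner y (z::'a::complex_inner)"
  using cinner_add_left[of x "- y" z] by (simp add: cinner_minus)

lemma cinner_diff_right: "cinner x (y - z) = cinner x y - cinner x (z::'a::complex_inner)"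
  using cinner_add_right[of x y "- z"] by (simp add: cinner_minus)

lemmas cinner_simps = cinner_add_left cinner_add_right cinner_diff_left cinner_diff_right
  cinner_scaleC_left cinner_scaleC_right

lemma cinner_self: "cinner x x = of_real ((norm (x::'a::complex_inner))\<^sup>2)"
proof -
  have "Im (cinner x x) = 0"
    using cinner_commute[of x x] by (simp add: complex_eq_iff)
  then show ?thesis by (simp add: complex_eq_iff Re_cinner power2_norm_eq_inner)
qed

lemma cinner_self_eq_0 [simp]: "cinner x x = 0 \<longleftrightarrow> x = (0::'a::complex_inner)"
  by (simp add: cinner_self)

lemma norm_scaleC: "norm (a *\<^sub>C x) = cmod a * norm (x::'a::complex_inner)"
proof -
  have "cinner (a *\<^sub>C x) (a *\<^sub>C x) = a * cnj a * cinner x x"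
    by (simp add: cinner_simps mult.left_commute)
  then have "complex_of_real ((norm (a *\<^sub>C x))\<^sup>2) = a * cnj a * of_real ((norm x)\<^sup>2)"
    by (simp only: cinner_self)
  also have "\<dots> = complex_of_real ((cmod a * norm x)\<^sup>2)"
    by (simp add: complex_mult_cnj power_mult_distrib cmod_power2)
  finally have "(norm (a *\<^sub>C x))\<^sup>2 = (cmod a * norm x)\<^sup>2"
    using of_real_eq_iff by blast
  then show ?thesis by simp
qed

text \<open>A unimodular factor on x makes a nonzero inner product real and positive without
  changing norms, which reduces the claim to the real Cauchy-Schwarz inequality.\<close>

lemma norm_cinner_le: "cmod (cinner x y) \<le> norm x * norm (y::'a::complex_inner)"
proof (cases "cinner x y = 0")
  case False
  define a where "a = cnj (cinner x y) / cmod (cinner x y)"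
  have "cinner (a *\<^sub>C x) y = of_real (cmod (cinner x y))"
    using False complex_norm_square[of "cinner x y"]
    by (simp add: a_def cinner_simps power2_eq_square field_simps)
  then have "cmod (cinner x y) = inner (a *\<^sub>C x) y"
    by (metis Re_cinner Re_complex_of_real)
  also have "\<dots> \<le> norm (a *\<^sub>C x) * norm y" by (rule norm_cauchy_schwarz)
  also have "norm (a *\<^sub>C x) = norm x" using False by (simp add: norm_scaleC a_def norm_divide)
  finally show ?thesis .
qed simp

lemma bounded_linear_cinner_left: "bounded_linear (\<lambda>x. cinner x (y::'a::complex_inner))"
  by (rule bounded_linear_intro[where K = "norm y"])
    (auto simp: cinner_simps scaleC_of_real[symmetric] scaleR_conv_of_real norm_cinner_le)

lemma continuous_on_cinner_left: "continuous_on A (\<lambda>x. cinner x (y::'a::complex_inner))"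
  using bounded_linear_cinner_left by (rule linear_continuous_on)

lemma bounded_linear_scaleC: "bounded_linear (\<lambda>x::'a::complex_inner. a *\<^sub>C x)"
  by (rule bounded_linear_intro[where K = "cmod a"])
    (auto simp: scaleC_add_right scaleC_of_real[symmetric] scaleC_scaleC norm_scaleC mult.commute)

lemma csubspace_imp_subspace:
  "complex_vector.subspace M \<Longrightarrow> subspace (M::'a::complex_inner set)"
  by (auto simp: complex_vector.subspace_def subspace_def scaleC_of_real[symmetric])

section \<open>Complex Riesz representation, orthogonal projections and adjoints\<close>

lemma riesz_on_csubspace:
  fixes M :: "'a::complex_hilbert set"
  assumes M: "closed_csubspace M"
    and add: "\<And>x y. x \<in> M \<Longrightarrow> y \<in> M \<Longrightarrow> f (x + y) = f x + f y"
    and scale: "\<And>a x. x \<in> M \<Longrightarrow> f (a *\<^sub>C x) = a * f x"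
    and bound: "\<And>x. x \<in> M \<Longrightarrow> cmod (f x) \<le> K * norm x"
  obtains z where "z \<in> M" "\<And>y. y \<in> M \<Longrightarrow> cinner y z = f y"
proof -
  have sub: "complex_vector.subspace M" "closed M" using M by (auto simp: closed_csubspace_def)
  obtain z where z: "z \<in> M" "\<And>y. y \<in> M \<Longrightarrow> inner y z = Re (f y)"
  proof (rule inner_riesz_on_subspace[of M "\<lambda>x. Re (f x)" K])
    fix x assume "x \<in> M"
    then show "\<bar>Re (f x)\<bar> \<le> K * norm x" using bound abs_Re_le_cmod order_trans by blast
  qed (use sub in \<open>auto simp: csubspace_imp_subspace add scale scaleC_of_real[symmetric]\<close>)
  \<comment> \<open>The vector z represents only the real part of f so far. Testing at -iy recovers
    the imaginary part, since Re(-iw) = Im w.\<close>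
  have "cinner y z = f y" if y: "y \<in> M" for y
  proof -
    have "inner ((- \<i>) *\<^sub>C y) z = Re (f ((- \<i>) *\<^sub>C y))"
      by (intro z complex_vector.subspace_scale sub y)
    then have "Im (cinner y z) = Im (f y)"
      by (simp add: Re_cinner[symmetric] cinner_simps scale[OF y] del: complex_vector.scale_minus_left)
    then show ?thesis using z(2)[OF y] by (simp add: complex_eq_iff Re_cinner)
  qed
  with z(1) show ?thesis by (rule that)
qed

lemma orthogonal_projection_exists:
  fixes M :: "'a::complex_hilbert set"
  assumes "closed_csubspace M"
  obtains p where "p \<in> M" "x - p \<in> UNIV \<ominus>\<^sub>H M"
proof -
  obtain p where p: "p \<in> M" "\<And>y. y \<in> M \<Longrightarrow> cinner y p = cinner y x"
    by (rule riesz_on_csubspace[OF assms, of "\<lambda>y. cinner y x" "norm x"])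
      (use norm_cinner_le in \<open>auto simp: cinner_simps mult.commute\<close>)
  have "cinner (x - p) y = 0" if "y \<in> M" for y
    using p(2)[OF that] cinner_commute[of x y] cinner_commute[of p y] by (simp add: cinner_simps)
  with p(1) show ?thesis by (intro that) (auto simp: ominus_def)
qed

text \<open>Two representing vectors in \<open>M\<close> differ by a vector of \<open>M\<close>
  orthogonal to all of \<open>M\<close>, hence to itself.\<close>

lemma adj_eqI:
  assumes M: "complex_vector.subspace M" and z: "z \<in> M"
    and eq: "\<And>x. x \<in> M \<Longrightarrow> cinner (T x) y = cinner x z"
  shows "adj M T y = z"
  unfolding adj_def
proof (rule the_equality)
  fix w assume w: "w \<in> M \<and> (\<forall>x\<in>M. cinner (T x) y = cinner x w)"
  then have "w - z \<in> M" using complex_vector.subspace_diff[OF M] z by blast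
  then have "cinner (w - z) (w - z) = 0"
    using w eq by (simp add: cinner_diff_right[of "w - z"])
  then show "w = z" by simp
qed (use z eq in auto)

text \<open>For fixed y, the functional sending x to the inner product of \<open>T x\<close> with y
  is linear and bounded on \<open>M\<close>, so the Riesz theorem supplies the vector that the
  definite description in \<open>adj\<close> refers to.\<close>

lemma cinner_adj:
  fixes M :: "'a::complex_hilbert set"
  assumes M: "closed_csubspace M" and T: "bounded_op M N T"
  shows "adj M T y \<in> M" "\<And>x. x \<in> M \<Longrightarrow> cinner x (adj M T y) = cinner (T x) y"
proof -
  obtain K where K: "\<And>x. x \<in> M \<Longrightarrow> norm (T x) \<le> K * norm x"
    using T unfolding bounded_op_def by blast
  obtain z where z: "z \<in> M" "\<And>x. x \<in> M \<Longrightarrow> cinner x z = cinner (T x) y"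
  proof (rule riesz_on_csubspace[OF M, of "\<lambda>x. cinner (T x) y" "K * norm y"])
    fix x assume "x \<in> M"
    have "cmod (cinner (T x) y) \<le> norm (T x) * norm y" by (rule norm_cinner_le)
    also have "\<dots> \<le> K * norm x * norm y" using K[OF \<open>x \<in> M\<close>] by (rule mult_right_mono) simp
    finally show "cmod (cinner (T x) y) \<le> K * norm y * norm x" by (simp add: mult.commute mult.left_commute)
  qed (use T in \<open>auto simp: bounded_op_def cinner_simps\<close>)
  then have "adj M T y = z"
    using M by (intro adj_eqI) (auto simp: closed_csubspace_def)
  with z show "adj M T y \<in> M" "\<And>x. x \<in> M \<Longrightarrow> cinner x (adj M T y) = cinner (T x) y" by auto
qed

text \<open>Gives access to the convergence theorems for absolutely summable families, which the
  square root series relies on.\<close>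

instance complex_hilbert \<subseteq> banach ..

section \<open>The Taylor coefficients of (1 - z)^(1/2) at 0\<close>

definition sqrt_coeff :: "nat \<Rightarrow> real" where
  "sqrt_coeff n = (- 1) ^ n * ((1/2) gchoose n)"

lemma sqrt_coeff_0 [simp]: "sqrt_coeff 0 = 1" by (simp add: sqrt_coeff_def)

text \<open>Writing c for the coefficients, (n+2) c(n+2) = (n+1/2) c(n+1) for n >= 0, so the sign of
  c(1) = -1/2 propagates.\<close>

lemma sqrt_coeff_nonpos: "sqrt_coeff (Suc n) \<le> 0"
proof (induction n)
  case (Suc n)
  have "sqrt_coeff (Suc (Suc n)) * (real n + 2) = sqrt_coeff (Suc n) * (real n + 1/2)"
    using arg_cong[OF gbinomial_mult_1[of "1/2 :: real" "Suc n"], of "\<lambda>u. (-1) ^ n * u"]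
    by (simp add: sqrt_coeff_def algebra_simps)
  moreover have "sqrt_coeff (Suc n) * (real n + 1/2) \<le> 0"
    using Suc by (intro mult_nonpos_nonneg) auto
  ultimately have "sqrt_coeff (Suc (Suc n)) * (real n + 2) \<le> 0" by simp
  then show ?case by (simp add: mult_le_0_iff)
qed (simp add: sqrt_coeff_def)

text \<open>Partial sums are the coefficients after division by 1 - z, here those of (1 - z)^(-1/2),
  which are quotients of rising factorials by factorials.\<close>

lemma sqrt_coeff_partial_sum_nonneg: "0 \<le> (\<Sum>k\<le>n. sqrt_coeff k)"
proof -
  have "(\<Sum>k\<le>n. sqrt_coeff k) = (- 1) ^ n * ((- (1/2)) gchoose n)"
    using gbinomial_sum_lower_neg[of "1/2::real" n] by (simp add: sqrt_coeff_def mult.commute)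
  also have "\<dots> = pochhammer (1/2) n / fact n"
    by (simp add: gbinomial_pochhammer flip: power_mult_distrib)
  also have "\<dots> \<ge> 0" by (intro divide_nonneg_nonneg pochhammer_nonneg) auto
  finally show ?thesis .
qed

text \<open>Only the zeroth coefficient, 1, is positive, so adding the signed partial sum to the
  absolute one leaves exactly 2.\<close>

lemma sum_abs_sqrt_coeff_le: "(\<Sum>k\<le>n. \<bar>sqrt_coeff k\<bar>) \<le> 2"
proof -
  have "(\<Sum>k\<le>n. \<bar>sqrt_coeff k\<bar>) + (\<Sum>k\<le>n. sqrt_coeff k) = 2"
    by (induction n) (simp_all add: abs_if sqrt_coeff_nonpos not_less antisym split: if_splits)
  then show ?thesis using sqrt_coeff_partial_sum_nonneg[of n] by linarith
qed

lemma sqrt_coeff_abs_summable: "(\<lambda>n. norm (sqrt_coeff n)) summable_on UNIV"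
proof -
  have "summable (\<lambda>n. norm (norm (sqrt_coeff n)))"
    using sum_abs_sqrt_coeff_le by (intro bounded_imp_summable[of _ 2]) auto
  then show ?thesis by (rule norm_summable_imp_summable_on)
qed

lemma infsum_sqrt_coeff_nonneg: "0 \<le> infsum sqrt_coeff UNIV"
proof -
  have "sqrt_coeff sums infsum sqrt_coeff UNIV"
    using sqrt_coeff_abs_summable Infinite_Sum.abs_summable_summable has_sum_imp_sums has_sum_infsum by blast
  then have "(\<lambda>n. \<Sum>k\<le>n. sqrt_coeff k) \<longlonglongrightarrow> infsum sqrt_coeff UNIV"
    by (simp add: sums_def_le)
  then show ?thesis
    by (rule LIMSEQ_le_const) (use sqrt_coeff_partial_sum_nonneg in auto)
qed

text \<open>The Cauchy square of the series is 1 - z: Vandermonde's identity adds the two exponents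
  1/2 to the exponent 1.\<close>

lemma sqrt_coeff_convolution:
  "(\<Sum>k\<le>n. sqrt_coeff k * sqrt_coeff (n - k)) = (if n = 0 then 1 else if n = 1 then -1 else 0)"
proof -
  have "(\<Sum>k\<le>n. sqrt_coeff k * sqrt_coeff (n - k)) =
      (\<Sum>k\<le>n. (-1) ^ n * (((1/2) gchoose k) * ((1/2) gchoose (n - k))))"
    by (intro sum.cong) (auto simp: sqrt_coeff_def simp flip: power_add)
  also have "\<dots> = (-1) ^ n * (1 gchoose n)"
    using gbinomial_Vandermonde[of "1/2::real" "1/2" n]
    by (simp add: sum_distrib_left[symmetric] atLeast0AtMost)
  also have "\<dots> = (if n = 0 then 1 else if n = 1 then -1 else 0)"
    using binomial_gbinomial[of 1 n, where ?'a = real] by (auto simp: binomial_eq_0)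
  finally show ?thesis .
qed

section \<open>The binomial series evaluated at a symmetric contraction\<close>

lemma positive_sqrt_exists:
  fixes Q :: "'a::complex_hilbert \<Rightarrow> 'a"
  assumes Q: "bounded_op UNIV UNIV Q"
    and contr: "\<And>x. norm (Q x) \<le> norm x"
    and sym: "\<And>x y. cinner (Q x) y = cinner x (Q y)"
  shows "\<exists>R. positive_op UNIV R \<and> (\<forall>x. R (R x) = x - Q x)"
proof -
  let ?q = "\<lambda>n. Q ^^ n"
  define R where "R x = (\<Sum>\<^sub>\<infinity>n. sqrt_coeff n *\<^sub>R ?q n x)" for x
  have q_add: "?q n (x + y) = ?q n x + ?q n y"
    and q_scale: "?q n (a *\<^sub>C x) = a *\<^sub>C ?q n x"
    and q_le: "norm (?q n x) \<le> norm x"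
    and q_sym: "cinner (?q n x) y = cinner x (?q n y)" for n x y a
  proof (induction n arbitrary: x y)
    case (Suc n)
    { case 1 then show ?case using Suc Q by (simp add: bounded_op_def) }
    { case 2 then show ?case using Suc Q by (simp add: bounded_op_def) }
    { case 3 then show ?case using Suc(3) contr order_trans by fastforce }
    { case 4 then show ?case using Suc(4) sym by (simp add: funpow_swap1) }
  qed simp_all
  have q_lin: "bounded_linear (?q n)" for n
    by (rule bounded_linear_intro[where K = 1])
      (auto simp: q_add q_le q_scale scaleC_of_real[symmetric])
  have abs_sum: "(\<lambda>n. norm (sqrt_coeff n *\<^sub>R ?q n x)) summable_on UNIV" for x
    by (rule Infinite_Sum.abs_summable_on_comparison_test[where g = "\<lambda>n. sqrt_coeff n * norm x"])
      (use sqrt_coeff_abs_summable in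
        \<open>auto simp: abs_mult q_le intro!: mult_left_mono summable_on_cmult_left\<close>)
  note summ = Infinite_Sum.abs_summable_summable[OF abs_sum]
  \<comment> \<open>Used for each bounded linear map that must pass through the series: complex
    scaling, the real and imaginary parts of the quadratic form, and the powers of
    \<open>Q\<close>.\<close>
  have inf_lin: "h (R x) = (\<Sum>\<^sub>\<infinity>n. sqrt_coeff n *\<^sub>R h (?q n x))"
    if h: "bounded_linear h" for h :: "'a \<Rightarrow> 'b::real_normed_vector" and x
    using has_sum_bounded_linear[OF h has_sum_infsum[OF summ[of x]], THEN infsumI]
    by (simp add: R_def linear_simps[OF h])
  define C where "C = (\<Sum>\<^sub>\<infinity>n. \<bar>sqrt_coeff n\<bar>)"
  have "norm (R x) \<le> C * norm x" for x
  proof -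
    have "norm (R x) \<le> (\<Sum>\<^sub>\<infinity>n. norm (sqrt_coeff n *\<^sub>R ?q n x))"
      unfolding R_def by (rule norm_infsum_bound[OF abs_sum])
    also have "\<dots> \<le> (\<Sum>\<^sub>\<infinity>n. \<bar>sqrt_coeff n\<bar> * norm x)"
      using sqrt_coeff_abs_summable
      by (intro infsum_mono abs_sum) (auto simp: q_le intro!: mult_left_mono summable_on_cmult_left)
    also have "\<dots> = C * norm x"
      using sqrt_coeff_abs_summable unfolding C_def by (intro infsum_cmult_left) simp
    finally show ?thesis .
  qed
  moreover have "R (x + y) = R x + R y" for x y
    by (simp add: R_def q_add scaleR_add_right infsum_add[OF summ summ])
  moreover have "R (a *\<^sub>C x) = a *\<^sub>C R x" for a x
    unfolding inf_lin[OF bounded_linear_scaleC] by (simp add: R_def q_scale)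
  ultimately have R_bdd: "bounded_op UNIV UNIV R" unfolding bounded_op_def by auto
  have R_pos: "cinner (R x) x \<in> \<real>\<^sub>\<ge>\<^sub>0" for x
  proof -
    have q_real: "Im (cinner (?q n x) x) = 0" for n
      using cinner_commute[of "?q n x" x] q_sym[of n x x] by (simp add: complex_eq_iff)
    have lin: "bounded_linear (\<lambda>v. Im (cinner v x))" "bounded_linear (\<lambda>v. Re (cinner v x))"
      by (intro bounded_linear_compose[OF bounded_linear_Im] bounded_linear_compose[OF bounded_linear_Re]
          bounded_linear_cinner_left)+
    have "Im (cinner (R x) x) = 0"
      unfolding inf_lin[OF lin(1)] by (simp add: q_real)
    \<comment> \<open>The quadratic form of each power of \<open>Q\<close> is at most the squared
      norm of x, with equality for n = 0. As all later coefficients are nonpositive, replacing every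
      form by that squared norm only lowers the sum, and the lowered sum is still
      nonnegative.\<close>
    moreover have "0 \<le> Re (cinner (R x) x)"
    proof -
      have "0 \<le> infsum sqrt_coeff UNIV * (norm x)\<^sup>2"
        by (simp add: infsum_sqrt_coeff_nonneg)
      also have "\<dots> = (\<Sum>\<^sub>\<infinity>n. sqrt_coeff n * (norm x)\<^sup>2)"
        using Infinite_Sum.abs_summable_summable[OF sqrt_coeff_abs_summable] by (simp add: infsum_cmult_left)
      also have "\<dots> \<le> (\<Sum>\<^sub>\<infinity>n. sqrt_coeff n *\<^sub>R Re (cinner (?q n x) x))"
      proof (rule infsum_mono)
        show "(\<lambda>n. sqrt_coeff n * (norm x)\<^sup>2) summable_on UNIV"
          using Infinite_Sum.abs_summable_summable[OF sqrt_coeff_abs_summable] by (rule summable_on_cmult_left)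
        show "(\<lambda>n. sqrt_coeff n *\<^sub>R Re (cinner (?q n x) x)) summable_on UNIV"
          using summable_on_bounded_linear[OF lin(2) summ[of x]] by (simp add: linear_simps[OF lin(2)])
        fix n
        have "Re (cinner (?q n x) x) \<le> norm (?q n x) * norm x"
          using norm_cauchy_schwarz by (simp add: Re_cinner)
        also have "\<dots> \<le> (norm x)\<^sup>2"
          unfolding power2_eq_square by (intro mult_right_mono q_le) simp
        finally have le: "Re (cinner (?q n x) x) \<le> (norm x)\<^sup>2" .
        show "sqrt_coeff n * (norm x)\<^sup>2 \<le> sqrt_coeff n *\<^sub>R Re (cinner (?q n x) x)"
        proof (cases n)
          case 0
          then show ?thesis by (simp add: cinner_self)
        next
          case (Suc k)
          then show ?thesis using mult_left_mono_neg[OF le sqrt_coeff_nonpos[of k]] by simp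
        qed
      qed
      also have "\<dots> = Re (cinner (R x) x)" by (rule inf_lin[OF lin(2), symmetric])
      finally show ?thesis .
    qed
    ultimately show ?thesis by (simp add: complex_nonneg_Reals_iff)
  qed
  have "R (R x) = x - Q x" for x
  proof -
    let ?f = "\<lambda>(i, j). (sqrt_coeff i * sqrt_coeff j) *\<^sub>R ?q (i + j) x"
    \<comment> \<open>Reindexes the double series along antidiagonals: n is the total power of
      \<open>Q\<close> and i <= n, so the natural subtraction is exact.\<close>
    let ?g = "\<lambda>(n, i). (n - i, i :: nat)"
    have "(\<lambda>p. norm (?f p)) summable_on UNIV \<times> UNIV"
    proof (rule Infinite_Sum.abs_summable_on_comparison_test)
      \<comment> \<open>A product family dominating the double series, because every power of
        \<open>Q\<close> is a contraction; its norms sum to a product of two convergent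
        sums.\<close>
      let ?h = "\<lambda>(i, j). sqrt_coeff i * (sqrt_coeff j * norm x)"
      show "(\<lambda>p. norm (?h p)) summable_on UNIV \<times> UNIV"
        using sqrt_coeff_abs_summable unfolding Infinite_Sum.abs_summable_on_Sigma_iff
        by (auto simp: abs_mult infsum_cmult_right' infsum_cmult_left'
            intro!: summable_on_cmult_left summable_on_cmult_right)
      show "norm (?f p) \<le> norm (?h p)" for p
        by (auto simp: abs_mult q_le mult.assoc intro!: mult_left_mono split: prod.split)
    qed
    then have f_sum: "?f summable_on UNIV \<times> UNIV" by (rule Infinite_Sum.abs_summable_summable)
    have bij: "bij_betw ?g (SIGMA n:UNIV. {..n}) (UNIV \<times> UNIV)"
      by (rule bij_betw_byWitness[where f' = "\<lambda>(i, j). (i + j, j)"]) auto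
    have "R (R x) = (\<Sum>\<^sub>\<infinity>i. \<Sum>\<^sub>\<infinity>j. ?f (i, j))"
    proof -
      have "?q i (R x) = (\<Sum>\<^sub>\<infinity>j. sqrt_coeff j *\<^sub>R ?q (i + j) x)" for i
        unfolding inf_lin[OF q_lin] by (simp add: funpow_add)
      then show ?thesis
        unfolding R_def[of "R x"] by (simp add: infsum_scaleR_right[symmetric])
    qed
    also have "\<dots> = infsum ?f (UNIV \<times> UNIV)"
      using infsum_Sigma'_banach[OF f_sum] by simp
    also have "\<dots> = infsum (\<lambda>p. ?f (?g p)) (SIGMA n:UNIV. {..n})"
      by (rule infsum_reindex_bij_betw[OF bij, symmetric])
    also have "\<dots> = (\<Sum>\<^sub>\<infinity>n. \<Sum>\<^sub>\<infinity>i\<in>{..n}. ?f (?g (n, i)))"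
      using summable_on_reindex_bij_betw[OF bij, of ?f] f_sum
      by (intro infsum_Sigma_banach[symmetric]) blast
    also have "\<dots> = (\<Sum>\<^sub>\<infinity>n. (\<Sum>i\<le>n. sqrt_coeff i * sqrt_coeff (n - i)) *\<^sub>R ?q n x)"
      by (intro infsum_cong) (simp add: scaleR_sum_left mult.commute)
    also have "\<dots> = (\<Sum>\<^sub>\<infinity>n\<in>{0, 1}. (if n = 0 then 1 else if n = 1 then -1 else 0) *\<^sub>R ?q n x)"
      unfolding sqrt_coeff_convolution by (rule infsum_cong_neutral) auto
    also have "\<dots> = x - Q x" by simp
    finally show ?thesis .
  qed
  with R_bdd R_pos show ?thesis unfolding positive_op_def by auto
qed

section \<open>Positive operators, contractions and orthogonal complements\<close>

lemma positive_op_symmetric: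
  fixes R :: "'a::complex_inner \<Rightarrow> 'a"
  assumes R: "positive_op UNIV R"
  shows "cinner (R x) y = cinner x (R y)"
proof -
  \<comment> \<open>Polarisation: d is sesquilinear and vanishes on the diagonal because the
    quadratic form is real. Evaluating it at x + y makes d antisymmetric, at x + iy
    symmetric.\<close>
  define d where "d x y = cinner (R x) y - cinner x (R y)" for x y
  have lin: "R (x + y) = R x + R y" "R (a *\<^sub>C x) = a *\<^sub>C R x" for x y a
    using R by (auto simp: positive_op_def bounded_op_def)
  have d0: "d v v = 0" for v
  proof -
    have "Im (cinner (R v) v) = 0" using R by (auto simp: positive_op_def complex_nonneg_Reals_iff)
    then show ?thesis
      using cinner_commute[of v "R v"] by (simp add: d_def complex_eq_iff)
  qed
  have "d x y + d y x = d (x + y) (x + y) - d x x - d y y"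
    by (simp add: d_def lin cinner_simps)
  then have 1: "d x y + d y x = 0" by (simp add: d0)
  have "\<i> * (d y x - d x y) = d (x + \<i> *\<^sub>C y) (x + \<i> *\<^sub>C y) - d x x - d y y"
    by (simp add: d_def lin cinner_simps algebra_simps)
  then have "d y x = d x y" by (simp add: d0)
  with 1 have "d x y = 0" by simp
  then show ?thesis by (simp add: d_def)
qed

text \<open>The supremum in \<open>op_norm\<close> dominates the quotients only once they are known
  to be bounded above, which the bound \<open>K\<close> from \<open>bounded_op\<close>
  provides.\<close>

lemma contraction_norm_le:
  assumes "contraction M T" "x \<in> M"
  shows "norm (T x) \<le> norm x"
proof -
  obtain K where K: "\<And>x. x \<in> M \<Longrightarrow> norm (T x) \<le> K * norm x"
    using assms unfolding contraction_def bounded_op_def by blast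
  have "norm (T x) / norm x \<le> \<bar>K\<bar>" if "x \<in> M" for x
  proof (cases "x = 0")
    case False
    then show ?thesis using K[OF that] by (simp add: divide_le_eq abs_if mult_right_mono order_trans)
  qed simp
  then have "bdd_above ((\<lambda>x. norm (T x) / norm x) ` M)" by (rule bdd_aboveI2)
  then have "norm (T x) / norm x \<le> op_norm M T"
    unfolding op_norm_def using assms(2) by (intro cSUP_upper)
  also have "\<dots> \<le> 1" using assms(1) by (simp add: contraction_def)
  \<comment> \<open>At x = 0 the quotient is 0 by convention and says nothing about
    \<open>T x\<close>; there the bound by \<open>K * norm x\<close> is used.\<close>
  finally show ?thesis using K[OF assms(2)] by (cases "x = 0") (auto simp: divide_le_eq)
qed

lemma contractionI:
  assumes "M \<noteq> {}" "bounded_op M M T" "\<And>x. x \<in> M \<Longrightarrow> norm (T x) \<le> norm x"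
  shows "contraction M T"
proof -
  have "norm (T x) / norm x \<le> 1" if "x \<in> M" for x
    using assms(3)[OF that] by (cases "x = 0") simp_all
  then show ?thesis
    unfolding contraction_def op_norm_def using assms(1,2) by (auto intro!: cSUP_least)
qed

lemma csubspace_closure:
  fixes M :: "'a::complex_inner set"
  assumes M: "complex_vector.subspace M"
  shows "complex_vector.subspace (closure M)"
  unfolding complex_vector.subspace_def
proof (intro conjI ballI allI)
  show "0 \<in> closure M" using complex_vector.subspace_0[OF M] closure_subset by blast
next
  fix x y a assume "x \<in> closure M" "y \<in> closure M"
  then obtain u v where u: "\<And>n. u n \<in> M" "u \<longlonglongrightarrow> x" and v: "\<And>n. v n \<in> M" "v \<longlonglongrightarrow> y"
    unfolding closure_sequential by blast
  show "x + y \<in> closure M"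
    unfolding closure_sequential using u v
    by (intro exI[of _ "\<lambda>n. u n + v n"]) (auto intro!: tendsto_add complex_vector.subspace_add M)
  show "a *\<^sub>C x \<in> closure M"
    unfolding closure_sequential using u
    by (intro exI[of _ "\<lambda>n. a *\<^sub>C u n"])
      (auto intro!: bounded_linear.tendsto[OF bounded_linear_scaleC] complex_vector.subspace_scale M)
qed

lemma csubspace_ominus: "complex_vector.subspace (UNIV \<ominus>\<^sub>H M)"
  by (auto simp: complex_vector.subspace_def ominus_def cinner_simps)

text \<open>The vectors orthogonal to a fixed x form a closed set, so orthogonality to
  \<open>M\<close> extends to its closure.\<close>

lemma ominus_closure: "UNIV \<ominus>\<^sub>H closure M = UNIV \<ominus>\<^sub>H (M :: 'a::complex_inner set)"
proof -
  have "cinner x y = 0" if x: "\<And>y. y \<in> M \<Longrightarrow> cinner x y = 0" and "y \<in> closure M" for x y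
  proof -
    have swap: "cinner y x = 0 \<longleftrightarrow> cinner x y = 0" for y
      using cinner_commute[of x y] by simp
    have "closed {y. cinner y x = 0}"
      by (intro closed_Collect_eq continuous_on_cinner_left continuous_on_const)
    then have "closure M \<subseteq> {y. cinner y x = 0}"
      using x by (intro closure_minimal) (auto simp: swap)
    with that show ?thesis by (auto simp: swap)
  qed
  then show ?thesis using closure_subset[of M] by (auto simp: ominus_def)
qed

text \<open>Linearity and the values on \<open>M\<close> and its complement all come from uniqueness
  of the decomposition, \<open>P_eqI\<close>. The last identity is Pythagoras in polarised form and
  later yields unitarity.\<close>

lemma orthogonal_projection:
  fixes M :: "'a::complex_hilbert set"
  assumes M: "closed_csubspace M"
  obtains P where "\<And>x. P x \<in> M" "\<And>x. x - P x \<in> UNIV \<ominus>\<^sub>H M"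
    "\<And>x y. P (x + y) = P x + P y" "\<And>a x. P (a *\<^sub>C x) = a *\<^sub>C P x"
    "\<And>x. x \<in> M \<Longrightarrow> P x = x" "\<And>x. x \<in> UNIV \<ominus>\<^sub>H M \<Longrightarrow> P x = 0"
    "\<And>x y. cinner (x - P x) (y - P y) + cinner (P x) (P y) = cinner x y"
proof -
  have sub: "complex_vector.subspace M" using M by (simp add: closed_csubspace_def)
  obtain P where P: "P x \<in> M" "x - P x \<in> UNIV \<ominus>\<^sub>H M" for x
  proof -
    have "\<exists>p. p \<in> M \<and> x - p \<in> UNIV \<ominus>\<^sub>H M" for x
      using orthogonal_projection_exists[OF M, of x] by blast
    then show ?thesis using that by metis
  qed
  have P_eqI: "P x = a" if "a \<in> M" "x - a \<in> UNIV \<ominus>\<^sub>H M" for a x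
  proof -
    have "P x - a \<in> M" using P that by (intro complex_vector.subspace_diff sub)
    moreover have "(x - a) - (x - P x) \<in> UNIV \<ominus>\<^sub>H M"
      by (rule complex_vector.subspace_diff[OF csubspace_ominus that(2) P(2)])
    ultimately have "cinner (P x - a) (P x - a) = 0" by (simp add: ominus_def)
    then show ?thesis by simp
  qed
  have orth: "cinner (x - P x) (P y) = 0" "cinner (P y) (x - P x) = 0" for x y
    using P[of x] P[of y] cinner_commute[of "P y" "x - P x"] by (auto simp: ominus_def)
  show ?thesis
  proof (rule that[of P])
    fix x y a
    show "P (x + y) = P x + P y"
      using complex_vector.subspace_add[OF csubspace_ominus P(2)[of x] P(2)[of y]]
      by (intro P_eqI complex_vector.subspace_add sub P) (simp add: algebra_simps)
    show "P (a *\<^sub>C x) = a *\<^sub>C P x"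
      using complex_vector.subspace_scale[OF csubspace_ominus P(2)[of x], of a]
      by (intro P_eqI complex_vector.subspace_scale sub P)
        (simp add: complex_vector.scale_right_diff_distrib)
    show "P x = x" if "x \<in> M"
      using that by (intro P_eqI) (auto simp: ominus_def)
    show "P x = 0" if "x \<in> UNIV \<ominus>\<^sub>H M"
      using that by (intro P_eqI complex_vector.subspace_0 sub) auto
    have "cinner x y = cinner ((x - P x) + P x) ((y - P y) + P y)" by simp
    also have "\<dots> = cinner (x - P x) (y - P y) + cinner (P x) (P y)"
      by (simp only: cinner_add_left cinner_add_right orth add_0_left add_0_right)
    finally show "cinner (x - P x) (y - P y) + cinner (P x) (P y) = cinner x y" ..
  qed (rule P)+
qed

lemma closed_csubspace_UNIV: "closed_csubspace (UNIV :: 'a::complex_inner set)"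
  by (simp add: closed_csubspace_def complex_vector.subspace_def)

section \<open>The defect operator and defect space of a contraction\<close>

context
  fixes T :: "'a::complex_hilbert \<Rightarrow> 'a"
  assumes contr: "contraction UNIV T"
begin

lemma contraction_bounded_op: "bounded_op UNIV UNIV T"
  using contr by (simp add: contraction_def)

lemma contraction_norm_le_UNIV: "norm (T x) \<le> norm x"
  using contr by (rule contraction_norm_le) simp

lemma cinner_adj_right: "cinner x (adj UNIV T y) = cinner (T x) y"
  by (rule cinner_adj(2)[OF closed_csubspace_UNIV contraction_bounded_op]) simp

lemma cinner_adj_left: "cinner (adj UNIV T y) x = cinner y (T x)"
  using cinner_adj_right[of x y] cinner_commute by metis

text \<open>The squared norm of T*y is the inner product of TT*y with y; Cauchy-Schwarz and
  contractivity bound it by the product of the norms of T*y and y.\<close>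

lemma norm_adj_le: "norm (adj UNIV T y) \<le> norm y"
proof -
  let ?z = "adj UNIV T y"
  have "norm ?z * norm ?z = Re (cinner ?z ?z)" by (simp add: cinner_self power2_eq_square)
  also have "\<dots> \<le> cmod (cinner (T ?z) y)"
    by (simp add: cinner_adj_right complex_Re_le_cmod)
  also have "\<dots> \<le> norm (T ?z) * norm y" by (rule norm_cinner_le)
  also have "\<dots> \<le> norm ?z * norm y" by (intro mult_right_mono contraction_norm_le_UNIV) simp
  finally show ?thesis by (cases "?z = 0") auto
qed

text \<open>Existence of a square root justifies the choice in \<open>op_sqrt\<close>. Everything
  proved later about the defect operator rests on these two properties.\<close>

lemma defect_op_square:
  "positive_op UNIV (defect_op UNIV T)"
  "defect_op UNIV T (defect_op UNIV T x) = x - adj UNIV T (T x)"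
proof -
  let ?Q = "\<lambda>x. adj UNIV T (T x)"
  have eqI: "u = v" if "\<And>x. cinner x u = cinner x v" for u v :: 'a
    using that[of "u - v"] by (simp add: cinner_diff_right[of "u - v"] flip: right_minus_eq[of u v] cinner_self_eq_0)
  have le: "norm (?Q x) \<le> norm x" for x
    using norm_adj_le contraction_norm_le_UNIV order_trans by blast
  have "\<exists>R. positive_op UNIV R \<and> (\<forall>x. R (R x) = x - ?Q x)"
  proof (rule positive_sqrt_exists)
    have "?Q (x + y) = ?Q x + ?Q y" "?Q (a *\<^sub>C x) = a *\<^sub>C ?Q x" for x y a
      using contraction_bounded_op
      by (auto intro!: eqI simp: bounded_op_def cinner_adj_right cinner_add_right cinner_scaleC_right)
    then show "bounded_op UNIV UNIV ?Q"
      unfolding bounded_op_def using le by (auto intro!: exI[of _ 1])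
  qed (use le in \<open>auto simp: cinner_adj_right cinner_adj_left\<close>)
  from someI_ex[OF this[folded ball_UNIV]]
  show "positive_op UNIV (defect_op UNIV T)"
    "defect_op UNIV T (defect_op UNIV T x) = x - adj UNIV T (T x)"
    unfolding defect_op_def op_sqrt_def by auto
qed

lemma closed_csubspace_defect_space: "closed_csubspace (defect_space UNIV T)"
proof -
  let ?D = "defect_op UNIV T"
  have D: "bounded_op UNIV UNIV ?D" using defect_op_square(1) by (simp add: positive_op_def)
  have "complex_vector.subspace (range ?D)"
    unfolding complex_vector.subspace_def
  proof (intro conjI ballI allI)
    have "?D (0 *\<^sub>C 0) = 0 *\<^sub>C ?D 0" using D by (simp only: bounded_op_def) blast
    then show "0 \<in> range ?D" by (metis complex_vector.scale_zero_left rangeI)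
  next
    fix x y a assume "x \<in> range ?D" "y \<in> range ?D"
    then obtain u v where "x = ?D u" "y = ?D v" by blast
    then have "x + y = ?D (u + v)" "a *\<^sub>C x = ?D (a *\<^sub>C u)"
      using D by (simp_all add: bounded_op_def)
    then show "x + y \<in> range ?D" "a *\<^sub>C x \<in> range ?D" by auto
  qed
  then show ?thesis
    by (simp add: closed_csubspace_def defect_space_def csubspace_closure)
qed

text \<open>With D the defect operator, symmetry turns the complement of its range into ker D. This
  equals ker D^2, because the squared norm of Dx is the inner product of D^2 x with x.\<close>

lemma ominus_defect_space: "UNIV \<ominus>\<^sub>H defect_space UNIV T = {x. adj UNIV T (T x) = x}"
proof -
  let ?D = "defect_op UNIV T"
  note sym = positive_op_symmetric[OF defect_op_square(1)]
  have "UNIV \<ominus>\<^sub>H defect_space UNIV T = {x. \<forall>y. cinner (?D x) y = 0}"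
    by (simp add: defect_space_def ominus_closure) (auto simp: ominus_def sym)
  also have "\<dots> = {x. ?D (?D x) = 0}"
  proof -
    have "cinner (?D x) y = 0" if "?D (?D x) = 0" for x y
    proof -
      have "cinner (?D x) (?D x) = 0" using that sym[of "?D x" x] by simp
      then show ?thesis by simp
    qed
    moreover have "?D (?D x) = 0" if "\<forall>y. cinner (?D x) y = 0" for x
    proof -
      have "cinner (?D (?D x)) (?D (?D x)) = 0" using that by (simp add: sym[of "?D x"])
      then show ?thesis by simp
    qed
    ultimately show ?thesis by blast
  qed
  also have "\<dots> = {x. adj UNIV T (T x) = x}" by (auto simp: defect_op_square(2))
  finally show ?thesis .
qed

section \<open>Hyponormality, purity and the shift part\<close>

lemma hyponormal_norm_adj_le:
  assumes "hyponormal UNIV T"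
  shows "norm (adj UNIV T z) \<le> norm (T z)"
proof -
  have "cinner (adj UNIV T (T z) - T (adj UNIV T z)) z \<in> \<real>\<^sub>\<ge>\<^sub>0"
    using assms by (auto simp: hyponormal_def op_le_def positive_op_def)
  \<comment> \<open>The order relation is read off from the quadratic form of T*T - TT*.\<close>
  moreover have "cinner (adj UNIV T (T z) - T (adj UNIV T z)) z =
      of_real ((norm (T z))\<^sup>2) - of_real ((norm (adj UNIV T z))\<^sup>2)"
    by (simp add: cinner_diff_left cinner_adj_left cinner_adj_right[symmetric] cinner_self)
  ultimately have "(norm (adj UNIV T z))\<^sup>2 \<le> (norm (T z))\<^sup>2"
    by (simp add: complex_nonneg_Reals_iff)
  then show ?thesis by (rule power2_le_imp_le) simp
qed

text \<open>For u = Tx, hyponormality gives |u| <= |Tu|. The squared norm of T*Tu - u expands to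
  |T*Tu|^2 - 2|Tu|^2 + |u|^2, and both outer terms are at most |Tu|^2, so it vanishes.\<close>

lemma hyponormal_kernel_invariant:
  assumes hyp: "hyponormal UNIV T" and x: "adj UNIV T (T x) = x"
  shows "adj UNIV T (T (T x)) = T x"
proof -
  let ?u = "T x" and ?W = "adj UNIV T"
  have "norm ?u \<le> norm (T ?u)"
    using contraction_norm_le_UNIV[of x] hyponormal_norm_adj_le[OF hyp, of ?u] x by simp
  then have ge: "(norm ?u)\<^sup>2 \<le> (norm (T ?u))\<^sup>2" by simp
  have le: "(norm (?W (T ?u)))\<^sup>2 \<le> (norm (T ?u))\<^sup>2" using norm_adj_le[of "T ?u"] by simp
  have "(norm (?W (T ?u) - ?u))\<^sup>2 = (norm (?W (T ?u)))\<^sup>2 - 2 * inner (?W (T ?u)) ?u + (norm ?u)\<^sup>2"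
    by (simp add: power2_norm_eq_inner inner_simps inner_commute)
  also have "inner (?W (T ?u)) ?u = (norm (T ?u))\<^sup>2"
    by (simp add: Re_cinner[symmetric] cinner_adj_left cinner_self)
  finally have "(norm (?W (T ?u) - ?u))\<^sup>2 \<le> 0" using ge le by linarith
  then show ?thesis by simp
qed

lemma pure_hyponormal_imp_unilateral_shift:
  assumes pure: "pure_hyponormal UNIV T"
  shows "unilateral_shift (UNIV \<ominus>\<^sub>H defect_space UNIV T) T"
proof -
  let ?K = "UNIV \<ominus>\<^sub>H defect_space UNIV T" and ?W = "adj UNIV T"
  note K = ominus_defect_space
  have hyp: "hyponormal UNIV T" using pure by (simp add: pure_hyponormal_def)
  have norm_T: "norm (T x) = norm x" if "x \<in> ?K" for x
    using that norm_adj_le[of "T x"] contraction_norm_le_UNIV[of x] unfolding K by simp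
  have "bounded_op ?K ?K T"
    using contraction_bounded_op hyponormal_kernel_invariant[OF hyp] norm_T
    unfolding bounded_op_def K by (auto intro!: exI[of _ 1])
  moreover have "N = {0}" if red: "reducing ?K T N" and un: "unitary_op N N T" for N
  proof -
    have N: "closed_csubspace N" "N \<subseteq> ?K" using red by (auto simp: reducing_def)
    have un': "bounded_op N N T" "\<forall>x\<in>N. \<forall>y\<in>N. cinner (T x) (T y) = cinner x y" and TN: "T ` N = N"
      using un unfolding unitary_op_def by simp_all
    have preimage: "\<exists>x\<in>N. y = T x" if "y \<in> N" for y
    proof -
      from that have "y \<in> T ` N" by (simp only: TN)
      then show ?thesis by blast
    qed
    have WN: "?W y \<in> N" if "y \<in> N" for y
    proof -
      obtain x where x: "x \<in> N" "y = T x" using preimage \<open>y \<in> N\<close> by blast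
      then have "?W (T x) = x" using N(2) unfolding K by blast
      with x show ?thesis by simp
    qed
    \<comment> \<open>Reduction inside \<open>?K\<close> controls only the complement of
      \<open>N\<close> in \<open>?K\<close>. The complement in the whole space is invariant because
      \<open>N\<close> is invariant under the adjoint of \<open>T\<close>.\<close>
    have "T x \<in> UNIV \<ominus>\<^sub>H N" if "x \<in> UNIV \<ominus>\<^sub>H N" for x
      using that WN by (auto simp: ominus_def cinner_adj_right[symmetric])
    then have "reducing UNIV T N" using N(1) TN by (simp add: reducing_def image_subset_iff)
    moreover have "normal_op N T"
    proof -
      \<comment> \<open>The adjoint taken relative to \<open>N\<close> inverts \<open>T\<close> on
        \<open>N\<close>, since \<open>T\<close> preserves inner products there.\<close>
      have adj_T: "adj N T (T x) = x" if "x \<in> N" for x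
        using N(1) that un'(2) by (intro adj_eqI) (simp_all add: closed_csubspace_def)
      have "T (adj N T x) = adj N T (T x)" if x: "x \<in> N" for x
      proof -
        obtain y where "y \<in> N" "x = T y" using preimage x by blast
        then show ?thesis using x adj_T by simp
      qed
      then show ?thesis using un'(1) by (simp add: normal_op_def)
    qed
    ultimately show ?thesis using pure by (auto simp: pure_hyponormal_def)
  qed
  ultimately show ?thesis
    using norm_T by (auto simp: unilateral_shift_def isometry_op_def)
qed

end

section \<open>The block triangular form\<close>

theorem proposition2p1:
  fixes T :: "'a::complex_hilbert \<Rightarrow> 'a"
  assumes "separable_space (euclidean :: 'a topology)"
    and "pure_hyponormal UNIV T"
    and "contraction UNIV T"
  shows "\<exists>S A B.
    unilateral_shift (UNIV \<ominus>\<^sub>H defect_space UNIV T) S \<and>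
    bounded_op (defect_space UNIV T) (UNIV \<ominus>\<^sub>H defect_space UNIV T) A \<and>
    contraction (defect_space UNIV T) B \<and>
    (\<forall>y\<in>defect_space UNIV T. adj (UNIV \<ominus>\<^sub>H defect_space UNIV T) S (A y) = 0) \<and>
    unitarily_equivalent UNIV T
      ((UNIV \<ominus>\<^sub>H defect_space UNIV T) \<times> defect_space UNIV T)
      (block_op S A (\<lambda>_. 0) B)"
proof -
  let ?D = "defect_space UNIV T" and ?K = "UNIV \<ominus>\<^sub>H defect_space UNIV T"
  note contr = assms(3)
  note closed_D = closed_csubspace_defect_space[OF contr]
  have shift: "unilateral_shift ?K T"
    using contr assms(2) by (rule pure_hyponormal_imp_unilateral_shift)
  then have T_K: "T x \<in> ?K" if "x \<in> ?K" for x
    using that by (simp add: unilateral_shift_def isometry_op_def bounded_op_def)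
  have T_lin: "T (x + y) = T x + T y" "T (a *\<^sub>C x) = a *\<^sub>C T x" for x y a
    using contraction_bounded_op[OF contr] by (auto simp: bounded_op_def)
  obtain P where P_D: "\<And>x. P x \<in> ?D" and P_K: "\<And>x. x - P x \<in> ?K"
    and P_add: "\<And>x y. P (x + y) = P x + P y" and P_scale: "\<And>a x. P (a *\<^sub>C x) = a *\<^sub>C P x"
    and P_id: "\<And>x. x \<in> ?D \<Longrightarrow> P x = x" and P_0: "\<And>x. x \<in> ?K \<Longrightarrow> P x = 0"
    and P_cinner: "\<And>x y. cinner (x - P x) (y - P y) + cinner (P x) (P y) = cinner x y"
    by (rule orthogonal_projection[OF closed_D]) (rule that)
  have "(norm (x - P x))\<^sup>2 + (norm (P x))\<^sup>2 = (norm x)\<^sup>2" for x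
    using P_cinner[of x x] unfolding cinner_self of_real_add[symmetric] of_real_eq_iff .
  then have "(norm (x - P x))\<^sup>2 \<le> (norm x)\<^sup>2" "(norm (P x))\<^sup>2 \<le> (norm x)\<^sup>2" for x
    by (smt (verit) zero_le_power2)+
  then have P_norm: "norm (x - P x) \<le> norm x" "norm (P x) \<le> norm x" for x
    by (auto intro: power2_le_imp_le)
  \<comment> \<open>\<open>T\<close> on the defect space splits into its components in
    \<open>?K\<close> and \<open>?D\<close>; the shift is \<open>T\<close> itself on
    \<open>?K\<close>, and \<open>?U\<close> lists the \<open>?K\<close>-component first.\<close>
  let ?A = "\<lambda>y. T y - P (T y)" and ?B = "\<lambda>y. P (T y)" and ?U = "\<lambda>x. (x - P x, P x)"
  have A_norm: "norm (?A y) \<le> norm y" and B_norm: "norm (?B y) \<le> norm y" for y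
    using P_norm[of "T y"] contraction_norm_le_UNIV[OF contr, of y] by linarith+
  have A: "bounded_op ?D ?K ?A"
    unfolding bounded_op_def using A_norm P_K
    by (auto simp: T_lin P_add P_scale complex_vector.scale_right_diff_distrib intro!: exI[of _ 1])
  have B: "contraction ?D ?B"
  proof (rule contractionI)
    show "bounded_op ?D ?D ?B"
      unfolding bounded_op_def using B_norm P_D
      by (auto simp: T_lin P_add P_scale intro!: exI[of _ 1])
  qed (use P_D B_norm in auto)
  have SA: "adj ?K T (?A y) = 0" if "y \<in> ?D" for y
  proof (rule adj_eqI[OF csubspace_ominus complex_vector.subspace_0[OF csubspace_ominus]])
    fix x assume x: "x \<in> ?K"
    \<comment> \<open>\<open>T x\<close> stays in \<open>?K\<close>, so it is orthogonal to the
      component of \<open>T y\<close> that \<open>?A\<close> removes.\<close>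
    have "cinner (T x) (?A y) = cinner (T x) (T y)"
      using T_K[OF x] P_D by (simp add: cinner_diff_right ominus_def)
    also have "\<dots> = cinner (adj UNIV T (T x)) y" by (simp add: cinner_adj_left[OF contr])
    also have "\<dots> = cinner x y" using x by (simp add: ominus_defect_space[OF contr])
    also have "\<dots> = cinner x 0" using x that by (simp add: ominus_def)
    finally show "cinner (T x) (?A y) = cinner x 0" .
  qed
  have U_cinner: "cinner (?U x) (?U y) = cinner x y" for x y
    by (simp add: cinner_prod_def P_cinner)
  have "complex_of_real ((norm (?U x))\<^sup>2) = of_real ((norm x)\<^sup>2)" for x
    unfolding cinner_self[symmetric] by (rule U_cinner)
  then have "norm (?U x) = norm x" for x
    unfolding of_real_eq_iff by simp
  then have "bounded_op UNIV (?K \<times> ?D) ?U"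
    unfolding bounded_op_def using P_K P_D
    by (auto simp: P_add P_scale scaleC_prod_def complex_vector.scale_right_diff_distrib
        intro!: exI[of _ 1])
  moreover have "range ?U = ?K \<times> ?D"
  proof -
    have "(k, d) \<in> range ?U" if "k \<in> ?K" "d \<in> ?D" for k d
      using that by (intro range_eqI[of _ _ "k + d"]) (simp add: P_add P_0 P_id)
    then show ?thesis using P_K P_D by auto
  qed
  ultimately have U: "unitary_op UNIV (?K \<times> ?D) ?U"
    using U_cinner by (simp add: unitary_op_def)
  \<comment> \<open>Invariance of \<open>?K\<close> means that \<open>P\<close> kills the image of
    the \<open>?K\<close>-component, which gives the zero block.\<close>
  have "?U (T x) = block_op T ?A (\<lambda>_. 0) ?B (?U x)" for x
  proof -
    have "T x = T (x - P x) + T (P x)" by (simp add: T_lin(1)[symmetric])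
    moreover have "P (T (x - P x)) = 0" by (intro P_0 T_K P_K)
    ultimately show ?thesis by (simp add: block_op_def P_add)
  qed
  with U have "unitarily_equivalent UNIV T (?K \<times> ?D) (block_op T ?A (\<lambda>_. 0) ?B)"
    unfolding unitarily_equivalent_def by blast
  with shift A B SA show ?thesis by blast
qed

end
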